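(* For every $A\in\mathrm{Form}$: $\models^A_{\mathcal W}A$ if and only if $A$ is a theorem of classical propositional logic ($\vdash_{\mathbf{CPC}}A$).
   Context: Formulas: $\mathrm{Var}$ is a countable set of variables; $\mathrm{Form}$ is generated from $\bot$ and $\mathrm{Var}$ by $\land,\lor,\to$; $\neg A$ abbreviates $A\to\bot$. Strict finitistic models: an intuitionistic frame $\langle K,\le\rangle$ is a nonempty partially ordered set; all frames are rooted and tree-like (there is a least element $r$, and for each $k$ the set $\{l: l\le k\}$ is a finite chain). An intuitionistic model $\langle K,\le,v\rangle$ adds $v:\mathrm{Var}\to\mathcal P(K)$ with each $v(p)$ closed upwards. It is a strict finitistic model if (1) the frame is finitely branching; (2) each branch has at most countable length; (3) for each $k\in K$, $\{p\in\mathrm{Var}: k\in v(p)\}$ is finite; (4) for every $p$, if $k\in v(p)$ for some $k$, then for every $l\in K$ there is $l'\ge l$ with $l'\in v(p)$. $\mathcal W$ is the class of all strict finitistic models (finite and infinite). Forcing in $W=\langle K,\le,v\rangle\in\mathcal W$: $k\models_W p$ iff $k\in v(p)$; $k\not\models_W\bot$; $k\models_W A\land B$ iff $k\models_W A$ and $k\models_W B$; $k\models_W A\lor B$ iff $k\models_W A$ or $k\models_W B$; $k\models_W A\to B$ iff for every $k'\ge k$ with $k'\models_W A$ there is $k''\ge k'$ with $k''\models_W B$. $A$ is assertible in $W$, written $\models^A_W A$, if $k\models_W A$ for some $k\in K$. $\models^A_{\mathcal W}A$ means $\models^A_W A$ for all $W\in\mathcal W$. *)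

theory Defs
  imports Main "HOL-Library.Countable_Set" "HOL-Library.Infinite_Typeclass"
begin

datatype 'v form =
    Falsum  (\<open>\<^bold>\<bottom>\<close>)
  | Var 'v
  | Conj "'v form" "'v form"  (infixr \<open>\<^bold>\<and>\<close> 75)
  | Disj "'v form" "'v form"  (infixr \<open>\<^bold>\<or>\<close> 70)
  | Imp "'v form" "'v form"  (infixr \<open>\<^bold>\<rightarrow>\<close> 65)

abbreviation Neg :: "'v form \<Rightarrow> 'v form"  (\<open>\<^bold>\<not> _\<close> [80] 80)
  where "\<^bold>\<not> A \<equiv> A \<^bold>\<rightarrow> \<^bold>\<bottom>"

(* A pair (k, l) in the accessibility relation means k \<le> l. *)
record ('w, 'v) model =
  worlds :: "'w set"
  le :: "('w \<times> 'w) set"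
  val :: "'v \<Rightarrow> 'w set"

definition rooted_tree_frame :: "'w set \<Rightarrow> ('w \<times> 'w) set \<Rightarrow> bool" where
  "rooted_tree_frame K R \<longleftrightarrow>
     partial_order_on K R \<and>
     (\<exists>r\<in>K. \<forall>k\<in>K. (r, k) \<in> R) \<and>
     (\<forall>k\<in>K. finite {l \<in> K. (l, k) \<in> R} \<and> total_on {l \<in> K. (l, k) \<in> R} R)"

definition intuitionistic_model :: "('w, 'v) model \<Rightarrow> bool" where
  "intuitionistic_model W \<longleftrightarrow>
     rooted_tree_frame (worlds W) (le W) \<and>
     (\<forall>p. val W p \<subseteq> worlds W) \<and>
     (\<forall>p k l. k \<in> val W p \<longrightarrow> (k, l) \<in> le W \<longrightarrow> l \<in> val W p)"

definition immediate_successors :: "'w set \<Rightarrow> ('w \<times> 'w) set \<Rightarrow> 'w \<Rightarrow> 'w set" where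
  "immediate_successors K R k =
     {l \<in> K. (k, l) \<in> R \<and> k \<noteq> l \<and>
        (\<forall>m\<in>K. (k, m) \<in> R \<longrightarrow> (m, l) \<in> R \<longrightarrow> m = k \<or> m = l)}"

(* Branches are maximal chains. *)
definition strict_finitistic_model :: "('w, 'v) model \<Rightarrow> bool" where
  "strict_finitistic_model W \<longleftrightarrow>
     intuitionistic_model W \<and>
     (\<forall>k\<in>worlds W. finite (immediate_successors (worlds W) (le W) k)) \<and>
     (\<forall>B. pred_on.maxchain (worlds W) (\<lambda>k l. (k, l) \<in> le W) B \<longrightarrow> countable B) \<and>
     (\<forall>k\<in>worlds W. finite {p. k \<in> val W p}) \<and>
     (\<forall>p. val W p \<noteq> {} \<longrightarrow> (\<forall>l\<in>worlds W. \<exists>l'\<in>worlds W. (l, l') \<in> le W \<and> l' \<in> val W p))"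

primrec forces :: "('w, 'v) model \<Rightarrow> 'w \<Rightarrow> 'v form \<Rightarrow> bool" where
  "forces W k \<^bold>\<bottom> \<longleftrightarrow> False"
| "forces W k (Var p) \<longleftrightarrow> k \<in> val W p"
| "forces W k (A \<^bold>\<and> B) \<longleftrightarrow> forces W k A \<and> forces W k B"
| "forces W k (A \<^bold>\<or> B) \<longleftrightarrow> forces W k A \<or> forces W k B"
| "forces W k (A \<^bold>\<rightarrow> B) \<longleftrightarrow>
     (\<forall>k'\<in>worlds W. (k, k') \<in> le W \<longrightarrow> forces W k' A \<longrightarrow>
        (\<exists>k''\<in>worlds W. (k', k'') \<in> le W \<and> forces W k'' B))"

definition assertible :: "('w, 'v) model \<Rightarrow> 'v form \<Rightarrow> bool" where
  "assertible W A \<longleftrightarrow> (\<exists>k\<in>worlds W. forces W k A)"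

(* Assertibility in all strict finitistic models whose worlds are drawn from the type 'w.
   A finitely branching tree in which every world has finitely many predecessors is
   countable, so any infinite type 'w contains an isomorphic copy of every strict
   finitistic model, finite or infinite. *)
definition assertible_in_all :: "'w::infinite itself \<Rightarrow> 'v form \<Rightarrow> bool" where
  "assertible_in_all _ A \<longleftrightarrow>
     (\<forall>W :: ('w, 'v) model. strict_finitistic_model W \<longrightarrow> assertible W A)"

(* Hilbert calculus: intuitionistic axioms plus double negation elimination. *)
inductive CPC :: "'v form \<Rightarrow> bool"  (\<open>\<turnstile>\<^sub>C\<^sub>P\<^sub>C _\<close> [60] 60) where
  K: "\<turnstile>\<^sub>C\<^sub>P\<^sub>C A \<^bold>\<rightarrow> B \<^bold>\<rightarrow> A"
| S: "\<turnstile>\<^sub>C\<^sub>P\<^sub>C (A \<^bold>\<rightarrow> B \<^bold>\<rightarrow> C) \<^bold>\<rightarrow> (A \<^bold>\<rightarrow> B) \<^bold>\<rightarrow> A \<^bold>\<rightarrow> C"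
| ConjI: "\<turnstile>\<^sub>C\<^sub>P\<^sub>C A \<^bold>\<rightarrow> B \<^bold>\<rightarrow> A \<^bold>\<and> B"
| ConjE1: "\<turnstile>\<^sub>C\<^sub>P\<^sub>C A \<^bold>\<and> B \<^bold>\<rightarrow> A"
| ConjE2: "\<turnstile>\<^sub>C\<^sub>P\<^sub>C A \<^bold>\<and> B \<^bold>\<rightarrow> B"
| DisjI1: "\<turnstile>\<^sub>C\<^sub>P\<^sub>C A \<^bold>\<rightarrow> A \<^bold>\<or> B"
| DisjI2: "\<turnstile>\<^sub>C\<^sub>P\<^sub>C B \<^bold>\<rightarrow> A \<^bold>\<or> B"
| DisjE: "\<turnstile>\<^sub>C\<^sub>P\<^sub>C (A \<^bold>\<rightarrow> C) \<^bold>\<rightarrow> (B \<^bold>\<rightarrow> C) \<^bold>\<rightarrow> A \<^bold>\<or> B \<^bold>\<rightarrow> C"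
| FalsumE: "\<turnstile>\<^sub>C\<^sub>P\<^sub>C \<^bold>\<bottom> \<^bold>\<rightarrow> A"
| NegNegE: "\<turnstile>\<^sub>C\<^sub>P\<^sub>C \<^bold>\<not> \<^bold>\<not> A \<^bold>\<rightarrow> A"
| MP: "\<turnstile>\<^sub>C\<^sub>P\<^sub>C A \<^bold>\<rightarrow> B \<Longrightarrow> \<turnstile>\<^sub>C\<^sub>P\<^sub>C A \<Longrightarrow> \<turnstile>\<^sub>C\<^sub>P\<^sub>C B"

end

(* In a strict finitistic model, condition (4) spreads from variables to all formulas: a formula
   forced somewhere is forced above every world. Hence assertibility obeys the classical truth
   tables for the valuation making p true iff p is forced somewhere. Conversely, every classical
   valuation of finitely many variables arises in this way from a one-point model. So
   assertibility in all models is classical validity, and Kalmar's completeness proof applies. *)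
theory Submission imports Defs begin

section \<open>Two-valued truth and soundness of the calculus\<close>

primrec sat :: "('v \<Rightarrow> bool) \<Rightarrow> 'v form \<Rightarrow> bool" where
  "sat V \<^bold>\<bottom> \<longleftrightarrow> False"
| "sat V (Var p) \<longleftrightarrow> V p"
| "sat V (A \<^bold>\<and> B) \<longleftrightarrow> sat V A \<and> sat V B"
| "sat V (A \<^bold>\<or> B) \<longleftrightarrow> sat V A \<or> sat V B"
| "sat V (A \<^bold>\<rightarrow> B) \<longleftrightarrow> (sat V A \<longrightarrow> sat V B)"

text \<open>Lets a valuation be replaced by one that is true at only finitely many variables, which
  is all that a one-point model can realise.\<close>

lemma sat_cong: "(\<And>p. p \<in> set_form A \<Longrightarrow> V p \<longleftrightarrow> V' p) \<Longrightarrow> sat V A \<longleftrightarrow> sat V' A"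
  by (induction A) auto

lemma finite_set_form: "finite (set_form A)"
  by (induction A) auto

lemma CPC_sound: "\<turnstile>\<^sub>C\<^sub>P\<^sub>C A \<Longrightarrow> sat V A"
  by (induction rule: CPC.induct) auto

subsection \<open>Completeness of the calculus\<close>

text \<open>Theorems enter whole through \<open>ax\<close>, so inductions over derivations from
  hypotheses have a single case for all axioms, and a derivation from no hypotheses collapses to a
  theorem.\<close>

inductive derives :: "'v form set \<Rightarrow> 'v form \<Rightarrow> bool"  (infix \<open>\<turnstile>\<close> 50) for \<Gamma> where
  asm: "A \<in> \<Gamma> \<Longrightarrow> \<Gamma> \<turnstile> A"
| ax: "\<turnstile>\<^sub>C\<^sub>P\<^sub>C A \<Longrightarrow> \<Gamma> \<turnstile> A"
| mp: "\<Gamma> \<turnstile> A \<^bold>\<rightarrow> B \<Longrightarrow> \<Gamma> \<turnstile> A \<Longrightarrow> \<Gamma> \<turnstile> B"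

lemma derives_empty: "{} \<turnstile> A \<Longrightarrow> \<turnstile>\<^sub>C\<^sub>P\<^sub>C A"
  by (induction rule: derives.induct) (auto intro: MP)

lemma derives_mono: "\<Gamma> \<turnstile> A \<Longrightarrow> \<Gamma> \<subseteq> \<Delta> \<Longrightarrow> \<Delta> \<turnstile> A"
  by (induction rule: derives.induct) (auto intro: derives.intros)

lemma derives_weaken: "\<Gamma> \<turnstile> A \<Longrightarrow> insert B \<Gamma> \<turnstile> A"
  by (erule derives_mono) blast

lemma derives_ImpI_weaken: "\<Gamma> \<turnstile> B \<Longrightarrow> \<Gamma> \<turnstile> A \<^bold>\<rightarrow> B"
  by (rule mp[OF ax[OF K]])

text \<open>The usual induction: \<open>K\<close> covers theorems and hypotheses other than
  \<open>A\<close>, the identity covers \<open>A\<close> itself, and \<open>S\<close> distributes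
  \<open>A\<close> over modus ponens.\<close>

lemma deduction:
  assumes "insert A \<Gamma> \<turnstile> B"
  shows "\<Gamma> \<turnstile> A \<^bold>\<rightarrow> B"
  using assms
proof (induction rule: derives.induct)
  case (asm B)
  \<comment> \<open>The identity as the combinator SKK, with the middle formula of \<open>S\<close>
    being the implication from \<open>A\<close> to itself.\<close>
  have "\<Gamma> \<turnstile> A \<^bold>\<rightarrow> A"
    by (rule mp[OF mp[OF ax[OF S] ax[OF K]] ax[OF K[of A A]]])
  with asm show ?case by (auto intro: derives_ImpI_weaken derives.asm)
next
  case (ax B)
  then show ?case by (intro derives_ImpI_weaken derives.ax)
next
  case (mp B C)
  from derives.mp[OF derives.mp[OF derives.ax[OF S] mp.IH(1)] mp.IH(2)] show ?case .
qed

lemma derives_NegE: "\<Gamma> \<turnstile> \<^bold>\<not> A \<Longrightarrow> \<Gamma> \<turnstile> A \<Longrightarrow> \<Gamma> \<turnstile> B"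
  by (rule mp[OF ax[OF FalsumE]], rule mp)

lemma derives_contrapos: "insert A \<Gamma> \<turnstile> B \<Longrightarrow> \<Gamma> \<turnstile> \<^bold>\<not> B \<Longrightarrow> \<Gamma> \<turnstile> \<^bold>\<not> A"
  by (meson deduction derives_NegE derives_weaken)

text \<open>Excluded middle as a rule, obtained from double negation elimination: under the negation
  of \<open>B\<close>, contraposition refutes both \<open>A\<close> and its negation.\<close>

lemma derives_cases:
  assumes "insert A \<Gamma> \<turnstile> B" and "insert (\<^bold>\<not> A) \<Gamma> \<turnstile> B"
  shows "\<Gamma> \<turnstile> B"
proof -
  let ?\<Delta> = "insert (\<^bold>\<not> B) \<Gamma>"
  have neg: "?\<Delta> \<turnstile> \<^bold>\<not> B" by (simp add: asm)
  have "insert A ?\<Delta> \<turnstile> B" "insert (\<^bold>\<not> A) ?\<Delta> \<turnstile> B"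
    using assms[THEN derives_weaken, of "\<^bold>\<not> B"] by (simp_all add: insert_commute)
  then have "?\<Delta> \<turnstile> \<^bold>\<not> A" "?\<Delta> \<turnstile> \<^bold>\<not> \<^bold>\<not> A"
    using neg by (auto intro: derives_contrapos)
  then have "?\<Delta> \<turnstile> \<^bold>\<bottom>" by (rule mp[rotated])
  then show ?thesis by (rule mp[OF ax[OF NegNegE] deduction])
qed

section \<open>Kalmar's argument\<close>

definition literal :: "('v \<Rightarrow> bool) \<Rightarrow> 'v \<Rightarrow> 'v form" where
  "literal V p = (if V p then Var p else \<^bold>\<not> Var p)"

text \<open>Kalmar's lemma: a row of the truth table, written as literals, decides the formula. With
  \<open>X\<close> fixed instead of \<open>set_form A\<close>, the induction hypotheses for both
  subformulas share one context and need no weakening.\<close>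

lemma derives_of_literals:
  assumes "set_form A \<subseteq> X"
  shows "literal V ` X \<turnstile> (if sat V A then A else \<^bold>\<not> A)"
  using assms
proof (induction A)
  case Falsum
  show ?case by (simp add: deduction asm)
next
  case (Var p)
  then have "literal V ` X \<turnstile> literal V p" by (intro asm) auto
  then show ?case by (simp add: literal_def)
next
  case (Conj A B)
  show ?case
  proof (cases "sat V A \<and> sat V B")
    case True
    with Conj show ?thesis by (auto intro: mp[OF mp[OF ax[OF ConjI]]])
  next
    case False
    have "insert (A \<^bold>\<and> B) (literal V ` X) \<turnstile> A" "insert (A \<^bold>\<and> B) (literal V ` X) \<turnstile> B"
      by (auto intro: mp[OF ax[OF ConjE1]] mp[OF ax[OF ConjE2]] asm)
    with False Conj show ?thesis by (auto intro: derives_contrapos split: if_splits)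
  qed
next
  case (Disj A B)
  show ?case
  proof (cases "sat V A \<or> sat V B")
    case True
    with Disj show ?thesis
      by (auto intro: mp[OF ax[OF DisjI1]] mp[OF ax[OF DisjI2]])
  next
    case False
    \<comment> \<open>\<open>DisjE\<close> with falsum as its conclusion: both disjuncts are
      refuted.\<close>
    with Disj show ?thesis by (auto intro: mp[OF mp[OF ax[OF DisjE]]])
  qed
next
  case (Imp A B)
  show ?case
  proof (cases "sat V A")
    case False
    with Imp have "literal V ` X \<turnstile> \<^bold>\<not> A" by simp
    then have "insert A (literal V ` X) \<turnstile> B"
      by (intro derives_NegE[OF derives_weaken asm]) auto
    with False show ?thesis by (simp add: deduction)
  next
    case True
    with Imp have A: "literal V ` X \<turnstile> A" by simp
    show ?thesis
    proof (cases "sat V B")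
      case True
      with Imp show ?thesis by (auto intro: derives_ImpI_weaken)
    next
      case False
      with Imp have "literal V ` X \<turnstile> \<^bold>\<not> B" by simp
      moreover have "insert (A \<^bold>\<rightarrow> B) (literal V ` X) \<turnstile> B"
        by (rule mp[OF asm derives_weaken[OF A]]) simp
      ultimately show ?thesis using \<open>sat V A\<close> False by (auto intro: derives_contrapos)
    qed
  qed
qed

text \<open>As the hypothesis covers every valuation, \<open>p\<close> can be discharged by
  comparing two valuations that differ only at \<open>p\<close>. The quantifier over
  \<open>V\<close> therefore stays inside the induction.\<close>

lemma eliminate_literals:
  assumes "finite X" and "\<And>V. literal V ` X \<turnstile> A"
  shows "{} \<turnstile> A"
  using assms
proof (induction X rule: finite_induct)
  case empty
  then show ?case by simp
next
  case (insert p X)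
  have "literal V ` X \<turnstile> A" for V
  proof (rule derives_cases)
    \<comment> \<open>Since \<open>p\<close> is not in \<open>X\<close>, changing its value leaves
      the other literals alone.\<close>
    have "literal (V(p := b)) ` X = literal V ` X" for b
      using insert.hyps(2) by (intro image_cong) (auto simp: literal_def)
    then have "insert (literal (V(p := b)) p) (literal V ` X) \<turnstile> A" for b
      using insert.prems[of "V(p := b)"] by (simp only: image_insert)
    from this[of True] this[of False]
    show "insert (Var p) (literal V ` X) \<turnstile> A" "insert (\<^bold>\<not> Var p) (literal V ` X) \<turnstile> A"
      by (simp_all add: literal_def)
  qed
  then show ?case by (rule insert.IH)
qed

text \<open>A tautology always falls in the positive branch of Kalmar's lemma, so it follows from
  every choice of literals, and these can be eliminated.\<close>

theorem CPC_complete: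
  assumes "\<And>V. sat V A"
  shows "\<turnstile>\<^sub>C\<^sub>P\<^sub>C A"
proof (rule derives_empty, rule eliminate_literals[OF finite_set_form])
  fix V
  show "literal V ` set_form A \<turnstile> A"
    using derives_of_literals[of A "set_form A" V] assms by simp
qed

subsection \<open>Assertibility is classical truth\<close>

locale strict_finitistic =
  fixes W :: "('w, 'v) model"
  assumes strict: "strict_finitistic_model W"
begin

lemma le_refl: "k \<in> worlds W \<Longrightarrow> (k, k) \<in> le W"
  using strict
  by (auto simp: strict_finitistic_model_def intuitionistic_model_def rooted_tree_frame_def
      partial_order_on_def preorder_on_def refl_on_def)

lemma le_trans: "(k, l) \<in> le W \<Longrightarrow> (l, m) \<in> le W \<Longrightarrow> (k, m) \<in> le W"
  using strict
  by (auto simp: strict_finitistic_model_def intuitionistic_model_def rooted_tree_frame_def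
      partial_order_on_def preorder_on_def elim: transE)

lemma worlds_nonempty: "worlds W \<noteq> {}"
  using strict
  by (auto simp: strict_finitistic_model_def intuitionistic_model_def rooted_tree_frame_def)

lemma val_worlds: "k \<in> val W p \<Longrightarrow> k \<in> worlds W"
  using strict by (auto simp: strict_finitistic_model_def intuitionistic_model_def)

lemma val_mono: "k \<in> val W p \<Longrightarrow> (k, l) \<in> le W \<Longrightarrow> l \<in> val W p"
  using strict by (auto simp: strict_finitistic_model_def intuitionistic_model_def)

lemma val_dense:
  "val W p \<noteq> {} \<Longrightarrow> l \<in> worlds W \<Longrightarrow> \<exists>l'\<in>worlds W. (l, l') \<in> le W \<and> l' \<in> val W p"
  using strict by (simp add: strict_finitistic_model_def)

lemma forces_mono: "forces W k A \<Longrightarrow> (k, l) \<in> le W \<Longrightarrow> forces W l A"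
  by (induction A) (auto intro: val_mono le_trans)

definition somewhere :: "'v \<Rightarrow> bool" where
  "somewhere p \<longleftrightarrow> val W p \<noteq> {}"

text \<open>The two claims need a joint induction because implication swaps them on the antecedent:
  each claim for an implication uses the other one for \<open>A\<close> and itself for
  \<open>B\<close>.\<close>

lemma forces_truth:
  shows forces_dense:
      "sat somewhere A \<Longrightarrow> l \<in> worlds W \<Longrightarrow> \<exists>l'\<in>worlds W. (l, l') \<in> le W \<and> forces W l' A"
    and forces_sat: "k \<in> worlds W \<Longrightarrow> forces W k A \<Longrightarrow> sat somewhere A"
proof (induction A arbitrary: k l)
  case (Var p)
  { case 1 then show ?case using val_dense by (simp add: somewhere_def) }
  { case 2 then show ?case by (auto simp: somewhere_def) }
next
  case (Conj A B)
  { case 1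
    then obtain m where m: "m \<in> worlds W" "(l, m) \<in> le W" "forces W m A"
      using Conj.IH(1) by auto
    \<comment> \<open>Density of \<open>B\<close> is applied above \<open>m\<close>, so that
      persistence carries \<open>A\<close> up to \<open>n\<close>.\<close>
    with 1 obtain n where "n \<in> worlds W" "(m, n) \<in> le W" "forces W n B"
      using Conj.IH(3) by auto
    with m show ?case by (auto intro: forces_mono le_trans) }
  { case 2 then show ?case using Conj.IH by auto }
next
  case (Disj A B)
  { case 1 then show ?case using Disj.IH(1,3) by auto }
  { case 2 then show ?case using Disj.IH(2,4) by auto }
next
  case (Imp A B)
  { case 1
    \<comment> \<open>No move upwards is needed: a world forcing \<open>A\<close> makes
      \<open>A\<close> true, hence \<open>B\<close>, and density of \<open>B\<close> gives the later
      world that the forcing clause asks for.\<close>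
    then have "forces W l (A \<^bold>\<rightarrow> B)" using Imp.IH(2,3) by auto
    with 1 show ?case using le_refl by blast }
  { case 2
    show ?case
    proof (simp, rule impI)
      assume "sat somewhere A"
      with 2 obtain m where "m \<in> worlds W" "(k, m) \<in> le W" "forces W m A"
        using Imp.IH(1) by blast
      with 2 obtain n where "n \<in> worlds W" "forces W n B" by auto
      then show "sat somewhere B" by (rule Imp.IH(4))
    qed }
qed auto

theorem assertible_iff_sat: "assertible W A \<longleftrightarrow> sat somewhere A"
  using forces_sat forces_dense worlds_nonempty unfolding assertible_def by blast

end

section \<open>One-point models\<close>

definition point_model :: "'w \<Rightarrow> 'v set \<Rightarrow> ('w, 'v) model" where
  "point_model w P = \<lparr>worlds = {w}, le = {(w, w)}, val = \<lambda>p. if p \<in> P then {w} else {}\<rparr>"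

text \<open>Finiteness of \<open>P\<close> is exactly condition (3); condition (4) holds because the
  only world already forces whatever is forced somewhere.\<close>

lemma strict_finitistic_point_model:
  assumes "finite P"
  shows "strict_finitistic (point_model w P)"
proof
  have "partial_order_on {w} {(w, w)}"
    by (auto simp: partial_order_on_def preorder_on_def refl_on_def trans_def antisym_def)
  moreover have "countable B" if "pred_on.maxchain {w} (\<lambda>k l. (k, l) \<in> {(w, w)}) B" for B
  proof -
    have "B \<subseteq> {w}"
      using that unfolding pred_on.maxchain_def pred_on.chain_def by blast
    then show ?thesis by (rule countable_subset) simp
  qed
  ultimately show "strict_finitistic_model (point_model w P)"
    using assms
    by (auto simp: strict_finitistic_model_def intuitionistic_model_def rooted_tree_frame_def
        immediate_successors_def point_model_def total_on_def)
qed

lemma somewhere_point_model: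
  assumes "finite P"
  shows "strict_finitistic.somewhere (point_model w P) p \<longleftrightarrow> p \<in> P"
  unfolding strict_finitistic.somewhere_def[OF strict_finitistic_point_model[OF assms]]
  by (simp add: point_model_def)

theorem corollary24:
  fixes A :: "'v::countable form"
  shows "assertible_in_all TYPE('w::infinite) A \<longleftrightarrow> \<turnstile>\<^sub>C\<^sub>P\<^sub>C A"
proof
  assume all: "assertible_in_all TYPE('w) A"
  show "\<turnstile>\<^sub>C\<^sub>P\<^sub>C A"
  proof (rule CPC_complete)
    fix V :: "'v \<Rightarrow> bool"
    \<comment> \<open>\<open>V\<close> may be true at infinitely many variables, so only those
      occurring in \<open>A\<close> are kept.\<close>
    define P where "P = {p \<in> set_form A. V p}"
    \<comment> \<open>Any element of the type can be the single world; \<open>undefined\<close> is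
      an arbitrary choice.\<close>
    define W :: "('w, 'v) model" where "W = point_model undefined P"
    have fin: "finite P" by (simp add: P_def finite_set_form)
    interpret strict_finitistic W
      unfolding W_def using fin by (rule strict_finitistic_point_model)
    have "sat somewhere A"
      using all strict assertible_iff_sat unfolding assertible_in_all_def by blast
    moreover have "somewhere p \<longleftrightarrow> V p" if "p \<in> set_form A" for p
      unfolding W_def somewhere_point_model[OF fin] using that by (simp add: P_def)
    ultimately show "sat V A" by (simp cong: sat_cong)
  qed
next
  assume "\<turnstile>\<^sub>C\<^sub>P\<^sub>C A"
  \<comment> \<open>Soundness is applied, for each model, to its own valuation
    \<open>somewhere\<close>.\<close>
  then show "assertible_in_all TYPE('w) A"
    unfolding assertible_in_all_def
    using CPC_sound strict_finitistic.assertible_iff_sat strict_finitistic.intro by blast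
qed

end
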